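(* Let $\Omega$ be a non-empty open subset of $\ell^2$. If $\Omega$ has a regular boundary, then $\Omega$ satisfies the strong segment condition.
   Context: $\ell^2$ is the real Hilbert space of square-summable sequences indexed by $\mathbb{N}$. Fix positive numbers $(a_i)_{i\ge1}$ with $\sum_i a_i<\infty$. $\widetilde H=\{\mathbf x=(x_i)\in\ell^2:\sum_i x_i^2/a_i^4<\infty\}$. For $i\in\mathbb{N}$, $P_{\mathbb{N}\setminus\{i\}}:\ell^2\to\ell^2(\mathbb{N}\setminus\{i\})$ is the map deleting the $i$-th coordinate. Regular boundary: for every $\mathbf x\in\partial\Omega$ there exist a neighbourhood $U_{\mathbf x}$ of $\mathbf x$, an index $i\in\mathbb{N}$, and a real-valued function $f$ on $P_{\mathbb{N}\setminus\{i\}}U_{\mathbf x}$ such that $U_{\mathbf x}\cap\Omega=\{\mathbf y\in U_{\mathbf x}:y_i<f(P_{\mathbb{N}\setminus\{i\}}\mathbf y)\}$ and $U_{\mathbf x}\cap\partial\Omega=\{\mathbf y\in U_{\mathbf x}:y_i=f(P_{\mathbb{N}\setminus\{i\}}\mathbf y)\}$. Strong segment condition: for every $\mathbf x\in\partial\Omega$ there exist a neighbourhood $U_{\mathbf x}\subset\ell^2$ of $\mathbf x$ and a nonzero vector $\mathbf y_{\mathbf x}\in\widetilde H$ such that $\mathbf z+t\mathbf y_{\mathbf x}\in\Omega$ for all $\mathbf z\in\overline\Omega\cap U_{\mathbf x}$ and all $t\in(0,1)$. *)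

theory Defs
  imports "HOL-Analysis.Analysis"
begin

section \<open>The real Hilbert space of square-summable sequences\<close>

lemma square_summable_mult:
  fixes x y :: "nat \<Rightarrow> real"
  assumes "summable (\<lambda>i. (x i)\<^sup>2)" "summable (\<lambda>i. (y i)\<^sup>2)"
  shows "summable (\<lambda>i. x i * y i)"
proof (rule summable_comparison_test')
  show "summable (\<lambda>i. (x i)\<^sup>2 + (y i)\<^sup>2)"
    using assms by (rule summable_add)
  show "norm (x i * y i) \<le> (x i)\<^sup>2 + (y i)\<^sup>2" for i
  proof -
    have "2 * (\<bar>x i\<bar> * \<bar>y i\<bar>) \<le> (x i)\<^sup>2 + (y i)\<^sup>2"
      using sum_squares_bound[of "\<bar>x i\<bar>" "\<bar>y i\<bar>"] by simp
    moreover have "0 \<le> \<bar>x i\<bar> * \<bar>y i\<bar>"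
      by simp
    ultimately show ?thesis
      unfolding real_norm_def abs_mult by linarith
  qed
qed

lemma square_summable_add:
  fixes x y :: "nat \<Rightarrow> real"
  assumes "summable (\<lambda>i. (x i)\<^sup>2)" "summable (\<lambda>i. (y i)\<^sup>2)"
  shows "summable (\<lambda>i. (x i + y i)\<^sup>2)"
proof -
  have "summable (\<lambda>i. (x i)\<^sup>2 + (y i)\<^sup>2 + 2 * (x i * y i))"
    by (intro summable_add summable_mult square_summable_mult assms)
  then show ?thesis
    by (simp add: power2_sum mult.assoc)
qed

lemma square_summable_scale:
  fixes x :: "nat \<Rightarrow> real"
  assumes "summable (\<lambda>i. (x i)\<^sup>2)"
  shows "summable (\<lambda>i. (c * x i)\<^sup>2)"
  unfolding power_mult_distrib by (intro summable_mult assms)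

typedef ell2 = "{x :: nat \<Rightarrow> real. summable (\<lambda>i. (x i)\<^sup>2)}"
  morphisms coord Abs_ell2
  by (rule exI[of _ "\<lambda>_. 0"]) simp

setup_lifting type_definition_ell2

lemma coord_square_summable: "summable (\<lambda>i. (coord x i)\<^sup>2)"
  using coord[of x] by simp

lemma ell2_eqI: "(\<And>i. coord x i = coord y i) \<Longrightarrow> x = y"
  by (metis coord_inject ext)

instantiation ell2 :: real_inner
begin

lift_definition zero_ell2 :: ell2 is "\<lambda>_. 0"
  by simp

lift_definition plus_ell2 :: "ell2 \<Rightarrow> ell2 \<Rightarrow> ell2" is "\<lambda>x y i. x i + y i"
  by (rule square_summable_add)

lift_definition uminus_ell2 :: "ell2 \<Rightarrow> ell2" is "\<lambda>x i. - x i"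
  by simp

lift_definition minus_ell2 :: "ell2 \<Rightarrow> ell2 \<Rightarrow> ell2" is "\<lambda>x y i. x i - y i"
  using square_summable_add[where y = "\<lambda>i. - y i" for y] by simp

lift_definition scaleR_ell2 :: "real \<Rightarrow> ell2 \<Rightarrow> ell2" is "\<lambda>c x i. c * x i"
  by (rule square_summable_scale)

definition inner_ell2 :: "ell2 \<Rightarrow> ell2 \<Rightarrow> real"
  where "inner_ell2 x y = (\<Sum>i. coord x i * coord y i)"

definition norm_ell2 :: "ell2 \<Rightarrow> real"
  where "norm_ell2 x = sqrt (inner x x)"

definition dist_ell2 :: "ell2 \<Rightarrow> ell2 \<Rightarrow> real"
  where "dist_ell2 x y = norm (x - y)"

definition sgn_ell2 :: "ell2 \<Rightarrow> ell2"
  where "sgn_ell2 x = inverse (norm x) *\<^sub>R x"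

definition uniformity_ell2 :: "(ell2 \<times> ell2) filter"
  where "uniformity_ell2 = (INF e\<in>{0 <..}. principal {(x, y). dist x y < e})"

definition open_ell2 :: "ell2 set \<Rightarrow> bool"
  where "open_ell2 S \<longleftrightarrow>
    (\<forall>x\<in>S. \<forall>\<^sub>F (x', y) in uniformity. x' = x \<longrightarrow> y \<in> S)"

instance
proof
  fix x y z :: ell2 and c d :: real
  show "x + y + z = x + (y + z)" by transfer (simp add: fun_eq_iff)
  show "x + y = y + x" by transfer (simp add: fun_eq_iff)
  show "0 + x = x" by transfer simp
  show "- x + x = 0" by transfer simp
  show "x - y = x + - y" by transfer (simp add: fun_eq_iff)
  show "c *\<^sub>R (x + y) = c *\<^sub>R x + c *\<^sub>R y" by transfer (simp add: fun_eq_iff algebra_simps)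
  show "(c + d) *\<^sub>R x = c *\<^sub>R x + d *\<^sub>R x" by transfer (simp add: fun_eq_iff algebra_simps)
  show "c *\<^sub>R d *\<^sub>R x = (c * d) *\<^sub>R x" by transfer (simp add: fun_eq_iff)
  show "1 *\<^sub>R x = x" by transfer simp
  show "dist x y = norm (x - y)" by (rule dist_ell2_def)
  show "sgn x = inverse (norm x) *\<^sub>R x" by (rule sgn_ell2_def)
  show "uniformity = (INF e\<in>{0 <..}. principal {(x :: ell2, y). dist x y < e})"
    by (rule uniformity_ell2_def)
  show "open U \<longleftrightarrow> (\<forall>x\<in>U. \<forall>\<^sub>F (x', y) in uniformity. x' = x \<longrightarrow> y \<in> U)"
    for U :: "ell2 set"
    by (rule open_ell2_def)
  show "inner x y = inner y x"
    by (simp add: inner_ell2_def mult.commute)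
  have sm: "summable (\<lambda>i. coord u i * coord v i)" for u v
    by (intro square_summable_mult coord_square_summable)
  show "inner (x + y) z = inner x z + inner y z"
    by (simp add: inner_ell2_def plus_ell2.rep_eq distrib_right suminf_add[OF sm sm])
  show "inner (c *\<^sub>R x) y = c * inner x y"
    by (simp add: inner_ell2_def scaleR_ell2.rep_eq mult.assoc suminf_mult[OF sm])
  show "0 \<le> inner x x"
    unfolding inner_ell2_def by (intro suminf_nonneg sm) simp
  show "inner x x = 0 \<longleftrightarrow> x = 0"
  proof
    assume "inner x x = 0"
    then have "\<forall>i. coord x i * coord x i = 0"
      unfolding inner_ell2_def using suminf_eq_zero_iff[OF sm[of x x]] by simp
    then show "x = 0"
      by (intro ell2_eqI) (simp add: zero_ell2.rep_eq)
  qed (simp add: inner_ell2_def zero_ell2.rep_eq)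
  show "norm x = sqrt (inner x x)" by (rule norm_ell2_def)
qed

end

lemma norm_ell2_square: "(norm x)\<^sup>2 = (\<Sum>i. (coord x i)\<^sup>2)"
  unfolding power2_norm_eq_inner inner_ell2_def by (simp add: power2_eq_square)

lemma sum_coord_le_norm: "(\<Sum>i<k. (coord x i)\<^sup>2) \<le> (norm x)\<^sup>2"
  unfolding norm_ell2_square by (intro sum_le_suminf coord_square_summable) auto

lemma abs_coord_le_norm: "\<bar>coord x i\<bar> \<le> norm x"
proof -
  have "(coord x i)\<^sup>2 \<le> (\<Sum>j<Suc i. (coord x j)\<^sup>2)"
    by (rule member_le_sum) auto
  also have "\<dots> \<le> (norm x)\<^sup>2"
    by (rule sum_coord_le_norm)
  finally show ?thesis
    by (simp add: abs_le_square_iff[symmetric])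
qed

instance ell2 :: complete_space
proof
  fix X :: "nat \<Rightarrow> ell2"
  assume X: "Cauchy X"
  have "\<exists>l. (\<lambda>n. coord (X n) i) \<longlonglongrightarrow> l" for i
  proof -
    have "Cauchy (\<lambda>n. coord (X n) i)"
    proof (rule metric_CauchyI)
      fix e :: real
      assume "e > 0"
      then obtain N where N: "\<And>m n. m \<ge> N \<Longrightarrow> n \<ge> N \<Longrightarrow> dist (X m) (X n) < e"
        using metric_CauchyD[OF X] by blast
      have "dist (coord (X m) i) (coord (X n) i) < e" if "m \<ge> N" "n \<ge> N" for m n
        using abs_coord_le_norm[of "X m - X n" i] N[OF that]
        by (simp add: dist_norm minus_ell2.rep_eq)
      then show "\<exists>M. \<forall>m\<ge>M. \<forall>n\<ge>M. dist (coord (X m) i) (coord (X n) i) < e"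
        by blast
    qed
    then show ?thesis
      by (simp add: Cauchy_convergent_iff convergent_def)
  qed
  then obtain L where L: "\<And>i. (\<lambda>n. coord (X n) i) \<longlonglongrightarrow> L i"
    by metis
  have bnd: "\<exists>N. \<forall>m\<ge>N. \<forall>k. (\<Sum>i<k. (coord (X m) i - L i)\<^sup>2) \<le> e\<^sup>2" if "e > 0" for e
  proof -
    from \<open>e > 0\<close> obtain N where N: "\<And>m n. m \<ge> N \<Longrightarrow> n \<ge> N \<Longrightarrow> dist (X m) (X n) < e"
      using metric_CauchyD[OF X] by blast
    have "(\<Sum>i<k. (coord (X m) i - L i)\<^sup>2) \<le> e\<^sup>2" if "m \<ge> N" for m k
    proof (rule LIMSEQ_le_const2)
      show "(\<lambda>n. \<Sum>i<k. (coord (X m) i - coord (X n) i)\<^sup>2) \<longlonglongrightarrow> (\<Sum>i<k. (coord (X m) i - L i)\<^sup>2)"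
        by (intro tendsto_intros L)
      have "(\<Sum>i<k. (coord (X m) i - coord (X n) i)\<^sup>2) \<le> e\<^sup>2" if "n \<ge> N" for n
      proof -
        have "(norm (X m - X n))\<^sup>2 \<le> e\<^sup>2"
          using N[OF \<open>m \<ge> N\<close> that] by (intro power_mono) (auto simp: dist_norm)
        then show ?thesis
          using sum_coord_le_norm[of "X m - X n" k] by (simp add: minus_ell2.rep_eq)
      qed
      then show "\<exists>N. \<forall>n\<ge>N. (\<Sum>i<k. (coord (X m) i - coord (X n) i)\<^sup>2) \<le> e\<^sup>2"
        by blast
    qed
    then show ?thesis
      by blast
  qed
  have summ: "summable (\<lambda>i. (coord (X m) i - L i)\<^sup>2)"
    if "\<forall>k. (\<Sum>i<k. (coord (X m) i - L i)\<^sup>2) \<le> b" for m and b :: real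
    using that by (intro bounded_imp_summable[where B = b])
      (auto simp del: sum.lessThan_Suc simp flip: lessThan_Suc_atMost)
  obtain N where "\<And>k. (\<Sum>i<k. (coord (X N) i - L i)\<^sup>2) \<le> 1\<^sup>2"
    using bnd[of 1] by auto
  then have "summable (\<lambda>i. (coord (X N) i - L i)\<^sup>2)"
    using summ by blast
  then have "summable (\<lambda>i. (L i - coord (X N) i)\<^sup>2)"
    by (simp add: power2_commute)
  from square_summable_add[OF this coord_square_summable[of "X N"]]
  have "summable (\<lambda>i. (L i)\<^sup>2)"
    by simp
  then have cL: "coord (Abs_ell2 L) = L"
    by (simp add: Abs_ell2_inverse)
  have "X \<longlonglongrightarrow> Abs_ell2 L"
  proof (rule metric_LIMSEQ_I)
    fix e :: real
    assume "e > 0"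
    then obtain N where N: "\<forall>m\<ge>N. \<forall>k. (\<Sum>i<k. (coord (X m) i - L i)\<^sup>2) \<le> (e / 2)\<^sup>2"
      using bnd[of "e / 2"] by auto
    have "dist (X m) (Abs_ell2 L) < e" if "m \<ge> N" for m
    proof -
      have k: "\<forall>k. (\<Sum>i<k. (coord (X m) i - L i)\<^sup>2) \<le> (e / 2)\<^sup>2"
        using N that by blast
      have "(norm (X m - Abs_ell2 L))\<^sup>2 \<le> (e / 2)\<^sup>2"
        unfolding norm_ell2_square minus_ell2.rep_eq cL
        using k by (intro suminf_le_const summ[OF k]) auto
      then have "norm (X m - Abs_ell2 L) \<le> e / 2"
        using \<open>e > 0\<close> by (simp add: power2_le_iff_abs_le)
      then show ?thesis
        using \<open>e > 0\<close> by (simp add: dist_norm)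
    qed
    then show "\<exists>N. \<forall>m\<ge>N. dist (X m) (Abs_ell2 L) < e"
      by blast
  qed
  then show "convergent X"
    by (rule convergentI)
qed


section \<open>Regular boundaries and the strong segment condition\<close>

definition H_tilde :: "(nat \<Rightarrow> real) \<Rightarrow> ell2 set"
  where "H_tilde a = {x. summable (\<lambda>i. (coord x i)\<^sup>2 / (a i) ^ 4)}"

text \<open>
  Elements of \<open>\<ell>\<^sup>2(\<nat> - {i})\<close> are represented as square-summable functions that are
  \<^const>\<open>extensional\<close> on \<open>\<nat> - {i}\<close>, so that the \<open>i\<close>-th coordinate is really forgotten.
\<close>

definition delete_coord :: "nat \<Rightarrow> ell2 \<Rightarrow> (nat \<Rightarrow> real)"
  where "delete_coord i x = restrict (coord x) (UNIV - {i})"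

text \<open>
  The function \<open>f\<close> below is total, but it is only ever applied to points of
  \<open>delete_coord i ` U\<close>; its values elsewhere are irrelevant. As usual, a neighbourhood of
  a point is any set having this point in its interior.
\<close>

definition regular_boundary :: "ell2 set \<Rightarrow> bool"
  where "regular_boundary \<Omega> \<longleftrightarrow>
    (\<forall>x\<in>frontier \<Omega>. \<exists>U i. \<exists>f :: (nat \<Rightarrow> real) \<Rightarrow> real.
       x \<in> interior U \<and>
       U \<inter> \<Omega> = {y \<in> U. coord y i < f (delete_coord i y)} \<and>
       U \<inter> frontier \<Omega> = {y \<in> U. coord y i = f (delete_coord i y)})"

definition strong_segment_condition :: "(nat \<Rightarrow> real) \<Rightarrow> ell2 set \<Rightarrow> bool"
  where "strong_segment_condition a \<Omega> \<longleftrightarrow>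
    (\<forall>x\<in>frontier \<Omega>. \<exists>U. \<exists>v\<in>H_tilde a.
       x \<in> interior U \<and> v \<noteq> 0 \<and>
       (\<forall>z \<in> closure \<Omega> \<inter> U. \<forall>t\<in>{0<..<1}. z + t *\<^sub>R v \<in> \<Omega>))"

end

theory Submission
  imports Defs
begin

text \<open>
  Near a boundary point, \<open>\<Omega>\<close> is the strict subgraph of a function of the coordinates other
  than the \<open>i\<close>-th, and its boundary is the graph. Moving a point of the closure in the
  direction \<open>- e\<^sub>i\<close> lowers the \<open>i\<close>-th coordinate and fixes the others, so as long as one
  stays in the neighbourhood one lands in \<open>\<Omega>\<close>. Every multiple of \<open>e\<^sub>i\<close> is finitely supported
  and hence belongs to \<^const>\<open>H_tilde\<close>.
\<close>

lift_definition ell2_unit :: "nat \<Rightarrow> ell2" is "\<lambda>i j. if j = i then 1 else 0"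
  by (rule summable_finite[where N = "{i}" for i]) auto

lemma norm_ell2_unit [simp]: "norm (ell2_unit i) = 1"
proof -
  have "(norm (ell2_unit i))\<^sup>2 = (\<Sum>j\<in>{i}. (coord (ell2_unit i) j)\<^sup>2)"
    unfolding norm_ell2_square by (rule suminf_finite) (auto simp: ell2_unit.rep_eq)
  then have "(norm (ell2_unit i))\<^sup>2 = 1"
    by (simp add: ell2_unit.rep_eq)
  then show ?thesis
    by (simp add: power2_eq_1_iff) (use norm_ge_zero[of "ell2_unit i"] in linarith)
qed

lemma scaleR_ell2_unit_in_H_tilde: "c *\<^sub>R ell2_unit i \<in> H_tilde a"
  unfolding H_tilde_def mem_Collect_eq
  by (rule summable_finite[where N = "{i}"]) (auto simp: scaleR_ell2.rep_eq ell2_unit.rep_eq)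

lemma coord_add_scaleR_ell2_unit [simp]:
  "coord (z + c *\<^sub>R ell2_unit i) i = coord z i + c"
  by (simp add: plus_ell2.rep_eq scaleR_ell2.rep_eq ell2_unit.rep_eq)

text \<open>Only the forgotten coordinate changes, so any function of \<open>delete_coord i\<close>
  is constant along lines in this direction.\<close>

lemma delete_coord_add_scaleR_ell2_unit [simp]:
  "delete_coord i (z + c *\<^sub>R ell2_unit i) = delete_coord i z"
  by (auto simp: delete_coord_def plus_ell2.rep_eq scaleR_ell2.rep_eq ell2_unit.rep_eq)

theorem proposition6p14:
  fixes a :: "nat \<Rightarrow> real" and \<Omega> :: "ell2 set"
  assumes "\<And>i. a i > 0"
    and "summable a"
    and "\<Omega> \<noteq> {}"
    and "open \<Omega>"
    and "regular_boundary \<Omega>"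
  shows "strong_segment_condition a \<Omega>"
  unfolding strong_segment_condition_def
proof
  fix x
  assume "x \<in> frontier \<Omega>"
  then obtain U i and f :: "(nat \<Rightarrow> real) \<Rightarrow> real"
    where U: "x \<in> interior U"
      and below: "U \<inter> \<Omega> = {y \<in> U. coord y i < f (delete_coord i y)}"
      and graph: "U \<inter> frontier \<Omega> = {y \<in> U. coord y i = f (delete_coord i y)}"
    using \<open>regular_boundary \<Omega>\<close> unfolding regular_boundary_def by meson
  obtain r where "r > 0" and r: "ball x r \<subseteq> U"
    using U mem_interior by blast
  \<comment> \<open>The sign is negative because \<open>\<Omega>\<close> lies below the graph. The
    length \<open>r / 2\<close> leaves room: a point within \<open>r / 2\<close> of
    \<open>x\<close>, moved by at most \<open>r / 2\<close>, stays in
    \<open>ball x r\<close>.\<close>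
  define v where "v = (- (r / 2)) *\<^sub>R ell2_unit i"
  have norm_v: "norm v = r / 2"
    using \<open>r > 0\<close> by (simp add: v_def)
  have "z + t *\<^sub>R v \<in> \<Omega>" if z: "z \<in> closure \<Omega> \<inter> ball x (r / 2)" and t: "t \<in> {0<..<1}" for z t
  proof -
    have "norm (t *\<^sub>R v) \<le> r / 2"
      using t \<open>r > 0\<close> by (simp add: norm_v)
    moreover have "dist x (z + t *\<^sub>R v) \<le> dist x z + norm (t *\<^sub>R v)"
      using dist_triangle[of x "z + t *\<^sub>R v" z] by (simp add: dist_norm)
    ultimately have "z + t *\<^sub>R v \<in> U"
      using z r by auto
    moreover have "z \<in> U"
      using z r \<open>r > 0\<close> by auto
    \<comment> \<open>The two cases feed \<open>below\<close> and \<open>graph\<close>: strict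
      inequality in \<open>\<Omega>\<close>, equality on the frontier.\<close>
    have "z \<in> \<Omega> \<or> z \<in> frontier \<Omega>"
      using z \<open>open \<Omega>\<close> by (auto simp: frontier_def interior_open)
    then have "coord z i \<le> f (delete_coord i z)"
      using \<open>z \<in> U\<close> below graph by (metis (mono_tags, lifting) IntI less_eq_real_def mem_Collect_eq)
    \<comment> \<open>Coordinate \<open>i\<close> drops by \<open>t * (r / 2)\<close>, which is
      positive since \<open>t > 0\<close>; this gives strictness even when \<open>z\<close> lies on
      the frontier.\<close>
    then have "coord (z + t *\<^sub>R v) i < f (delete_coord i (z + t *\<^sub>R v))"
      unfolding v_def scaleR_scaleR coord_add_scaleR_ell2_unit delete_coord_add_scaleR_ell2_unit
      using t \<open>r > 0\<close> by (smt (verit) greaterThanLessThan_iff half_gt_zero mult_minus_right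
          mult_pos_pos)
    ultimately show ?thesis
      using below by blast
  qed
  moreover have "x \<in> interior (ball x (r / 2))" and "v \<noteq> 0"
    using norm_v \<open>r > 0\<close> by auto
  moreover have "v \<in> H_tilde a"
    unfolding v_def by (rule scaleR_ell2_unit_in_H_tilde)
  ultimately show "\<exists>U. \<exists>v\<in>H_tilde a. x \<in> interior U \<and> v \<noteq> 0 \<and>
      (\<forall>z \<in> closure \<Omega> \<inter> U. \<forall>t\<in>{0<..<1}. z + t *\<^sub>R v \<in> \<Omega>)"
    by blast
qed

end
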